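(* Let $K$ be a field, $S=K[x_1,\ldots,x_n]$, and let $\Delta$ be a simplicial complex on the vertex set $[n]=\{1,\ldots,n\}$. Then $$\operatorname{sdepth} K[\operatorname{link}_\Delta(\{n\})]\ \ge\ \operatorname{sdepth} K[\Delta]-1.$$
   Context: For a simplicial complex $\Delta$ on a finite vertex set $V$, let $S_V=K[x_i: i\in V]$ and $x^G=\prod_{i\in G}x_i$ for $G\subset V$; the Stanley-Reisner ideal is $I_\Delta=(x^G: G\subset V,\ G\notin\Delta)\subset S_V$, and $K[\Delta]=S_V/I_\Delta$ (so $S_V=S$ for $V=[n]$). The link is $\operatorname{link}_\Delta(\{n\})=\{G\subset[n-1]: G\cup\{n\}\in\Delta\}$, regarded as a simplicial complex on $[n-1]$, so $K[\operatorname{link}_\Delta(\{n\})]$ is a quotient of $T=K[x_1,\ldots,x_{n-1}]$. Stanley depth: for a monomial ideal $I$ in a polynomial ring $R=K[x_i:i\in V]$ let $I^c$ be the $K$-linear span of all monomials of $R$ not in $I$. For a monomial $u\in R$ and a set $Z$ of variables of $R$, the $K$-subspace $uK[Z]$ with basis all monomials $uv$, $v$ a monomial of $K[Z]$, is called a Stanley space of dimension $|Z|$. A Stanley decomposition $\mathcal D$ of $R/I$ is a decomposition of $I^c$ as a finite direct sum of Stanley spaces; $\operatorname{sdepth}\mathcal D$ is the minimal dimension of a Stanley space in $\mathcal D$, and $\operatorname{sdepth} R/I$ is the maximum of $\operatorname{sdepth}\mathcal D$ over all Stanley decompositions $\mathcal D$ of $R/I$. *)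

theory Defs
  imports "HOL-Algebra.Ideal" "HOL-Library.Poly_Mapping" "HOL-Library.Extended_Real"
begin

text \<open>
  Polynomials have variables indexed by \<^typ>\<open>nat\<close>: a monomial is an exponent function of type
  \<^typ>\<open>nat \<Rightarrow>\<^sub>0 nat\<close>, and a polynomial is a finitely supported function from monomials to
  coefficients.  The ring $K[x_i : i \in V]$ is the subring of polynomials in which only
  variables from \<open>V\<close> occur.
\<close>

type_synonym 'k mpoly = "(nat \<Rightarrow>\<^sub>0 nat) \<Rightarrow>\<^sub>0 'k"

definition monomials :: "nat set \<Rightarrow> (nat \<Rightarrow>\<^sub>0 nat) set"
  where "monomials V = {m. Poly_Mapping.keys m \<subseteq> V}"

lemma zero_in_monomials: "0 \<in> monomials V"
  by (simp add: monomials_def)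

definition monom :: "(nat \<Rightarrow>\<^sub>0 nat) \<Rightarrow> 'k::field mpoly"
  where "monom m = Poly_Mapping.single m 1"

definition var :: "nat \<Rightarrow> 'k::field mpoly"
  where "var i = monom (Poly_Mapping.single i 1)"

definition scale :: "'k::field \<Rightarrow> 'k mpoly \<Rightarrow> 'k mpoly"
  where "scale c p = Poly_Mapping.single 0 c * p"

global_interpretation mpoly: vector_space "scale :: 'k::field \<Rightarrow> 'k mpoly \<Rightarrow> 'k mpoly"
  defines kspan = mpoly.span
proof
  fix a b :: 'k and x y :: "'k mpoly"
  show "scale a (x + y) = scale a x + scale a y"
    by (simp add: scale_def distrib_left)
  show "scale (a + b) x = scale a x + scale b x"
    by (simp add: scale_def single_add distrib_right)
  show "scale a (scale b x) = scale (a * b) x"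
    by (simp add: scale_def mult_single flip: mult.assoc)
  show "scale 1 x = x"
    by (simp add: scale_def)
qed

definition poly_ring :: "nat set \<Rightarrow> 'k::field mpoly ring"
  where "poly_ring V =
    \<lparr>carrier = {p. Poly_Mapping.keys p \<subseteq> monomials V}, mult = (*), one = 1, zero = 0, add = (+)\<rparr>"

lemma mult_closed_poly_ring:
  fixes x y :: "'k::field mpoly"
  assumes "Poly_Mapping.keys x \<subseteq> monomials V" "Poly_Mapping.keys y \<subseteq> monomials V"
  shows "Poly_Mapping.keys (x * y) \<subseteq> monomials V"
proof
  fix m
  assume "m \<in> Poly_Mapping.keys (x * y)"
  then obtain a b
    where "m = a + b" "a \<in> Poly_Mapping.keys x" "b \<in> Poly_Mapping.keys y"
    using Poly_Mapping.keys_mult[of x y] by blast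
  moreover from this assms have "a \<in> monomials V" "b \<in> monomials V"
    by blast+
  ultimately show "m \<in> monomials V"
    using Poly_Mapping.keys_add[of a b] by (simp add: monomials_def) blast
qed

lemma cring_poly_ring: "cring (poly_ring V :: 'k::field mpoly ring)"
proof (rule cringI)
  show "abelian_group (poly_ring V :: 'k mpoly ring)"
  proof (rule abelian_groupI)
    fix x :: "'k mpoly"
    assume "x \<in> carrier (poly_ring V)"
    then show "\<exists>y\<in>carrier (poly_ring V). y \<oplus>\<^bsub>poly_ring V\<^esub> x = \<zero>\<^bsub>poly_ring V\<^esub>"
      by (intro bexI[of _ "- x"]) (simp_all add: poly_ring_def)
  next
    fix x y :: "'k mpoly"
    assume "x \<in> carrier (poly_ring V)" "y \<in> carrier (poly_ring V)"
    then show "x \<oplus>\<^bsub>poly_ring V\<^esub> y \<in> carrier (poly_ring V)"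
      using Poly_Mapping.keys_add[of x y] by (simp add: poly_ring_def) blast
  qed (simp_all add: poly_ring_def add_ac)
next
  show "Group.comm_monoid (poly_ring V :: 'k mpoly ring)"
    by (rule Group.comm_monoidI)
      (simp_all add: poly_ring_def mult_closed_poly_ring zero_in_monomials mult_ac)
qed (simp add: poly_ring_def distrib_right)

definition simplicial_complex_on :: "nat set \<Rightarrow> nat set set \<Rightarrow> bool"
  where "simplicial_complex_on V \<Delta> \<longleftrightarrow>
    finite V \<and> \<Delta> \<subseteq> Pow V \<and> (\<forall>F\<in>\<Delta>. \<forall>G. G \<subseteq> F \<longrightarrow> G \<in> \<Delta>)"

definition vertex_link :: "nat set \<Rightarrow> nat set set \<Rightarrow> nat \<Rightarrow> nat set set"
  where "vertex_link V \<Delta> v = {G. G \<subseteq> V - {v} \<and> G \<union> {v} \<in> \<Delta>}"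

lemma simplicial_complex_on_vertex_link:
  assumes "simplicial_complex_on V \<Delta>"
  shows "simplicial_complex_on (V - {v}) (vertex_link V \<Delta> v)"
proof -
  have "G \<in> vertex_link V \<Delta> v" if F: "F \<in> vertex_link V \<Delta> v" and "G \<subseteq> F" for F G
  proof -
    have "F \<union> {v} \<in> \<Delta>" "G \<union> {v} \<subseteq> F \<union> {v}" "G \<subseteq> V - {v}"
      using that by (auto simp: vertex_link_def)
    with assms have "G \<union> {v} \<in> \<Delta>"
      unfolding simplicial_complex_on_def by simp
    with \<open>G \<subseteq> V - {v}\<close> show ?thesis
      by (simp add: vertex_link_def)
  qed
  moreover have "finite (V - {v})" "vertex_link V \<Delta> v \<subseteq> Pow (V - {v})"
    using assms by (auto simp: simplicial_complex_on_def vertex_link_def)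
  ultimately show ?thesis
    unfolding simplicial_complex_on_def by simp
qed

definition stanley_reisner_ideal :: "nat set \<Rightarrow> nat set set \<Rightarrow> 'k::field mpoly set"
  where "stanley_reisner_ideal V \<Delta> =
    Idl\<^bsub>poly_ring V\<^esub> {(\<Prod>i\<in>G. var i) |G. G \<subseteq> V \<and> G \<notin> \<Delta>}"

definition monomial_complement :: "nat set \<Rightarrow> 'k::field mpoly set \<Rightarrow> 'k mpoly set"
  where "monomial_complement V I = kspan {monom m |m. m \<in> monomials V \<and> monom m \<notin> I}"

text \<open>The product of the monomials \<open>u\<close> and \<open>v\<close> is \<^term>\<open>monom (u + v)\<close>.\<close>

definition stanley_space :: "(nat \<Rightarrow>\<^sub>0 nat) \<Rightarrow> nat set \<Rightarrow> 'k::field mpoly set"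
  where "stanley_space u Z = kspan {monom (u + v) |v. v \<in> monomials Z}"

definition is_direct_sum :: "'b::ab_group_add set \<Rightarrow> 'a set \<Rightarrow> ('a \<Rightarrow> 'b set) \<Rightarrow> bool"
  where "is_direct_sum W A U \<longleftrightarrow>
    W = {(\<Sum>i\<in>A. f i) |f. \<forall>i\<in>A. f i \<in> U i} \<and>
    (\<forall>f. (\<forall>i\<in>A. f i \<in> U i) \<and> (\<Sum>i\<in>A. f i) = 0 \<longrightarrow> (\<forall>i\<in>A. f i = 0))"

text \<open>
  A decomposition is given by the set of pairs \<open>(u, Z)\<close> of its Stanley spaces $u K[Z]$.
  Stanley spaces are nonzero, so none is repeated in a direct sum and a set suffices.
\<close>

definition stanley_decomposition ::
    "nat set \<Rightarrow> 'k::field mpoly set \<Rightarrow> ((nat \<Rightarrow>\<^sub>0 nat) \<times> nat set) set \<Rightarrow> bool"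
  where "stanley_decomposition V I D \<longleftrightarrow>
    finite D \<and> D \<subseteq> monomials V \<times> Pow V \<and>
    is_direct_sum (monomial_complement V I) D (\<lambda>(u, Z). stanley_space u Z)"

definition sdepth_decomposition :: "((nat \<Rightarrow>\<^sub>0 nat) \<times> nat set) set \<Rightarrow> enat"
  where "sdepth_decomposition D = (INF (u, Z)\<in>D. enat (card Z))"

text \<open>
  \<open>sdepth V I\<close> is the Stanley depth of $K[x_i : i \in V]/I$.  For $I$ proper and \<open>V\<close> finite, the
  values of \<^const>\<open>sdepth_decomposition\<close> are among $0, \ldots, |V|$ and the supremum is a maximum.
  The zero ring has only the empty decomposition, whence its Stanley depth is \<open>\<infinity>\<close>; this occurs for
  the link of \<open>v\<close> when \<open>{v}\<close> is not a face.
\<close>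

definition sdepth :: "nat set \<Rightarrow> 'k::field mpoly set \<Rightarrow> enat"
  where "sdepth V I = (SUP D\<in>{D. stanley_decomposition V I D}. sdepth_decomposition D)"

end

theory Submission
  imports Defs "HOL-Library.Disjoint_Sets"
begin

text \<open>
  Monomials outside a monomial ideal form a basis of its complement, so a Stanley decomposition is
  a partition of these monomials into cones \<open>u K[Z]\<close>.  A monomial \<open>m\<close> in the variables other than
  \<open>x\<^sub>v\<close> survives in the link iff \<open>m x\<^sub>v\<^sup>k\<close> survives in \<open>\<Delta>\<close>, for any \<open>k > 0\<close>.  Given a decomposition
  \<open>D\<close> for \<open>\<Delta>\<close>, choose \<open>k\<close> larger than all exponents of \<open>x\<^sub>v\<close> in the corners \<open>u\<close>: then only cones
  with \<open>v \<in> Z\<close> contain some \<open>m x\<^sub>v\<^sup>k\<close>, and slicing them at height \<open>k\<close> yields a decomposition for the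
  link whose cones have dimension one less.
\<close>

abbreviation keys :: "('a \<Rightarrow>\<^sub>0 'b::zero) \<Rightarrow> 'a set"
  where "keys \<equiv> Poly_Mapping.keys"

abbreviation lookup :: "('a \<Rightarrow>\<^sub>0 'b::zero) \<Rightarrow> 'a \<Rightarrow> 'b"
  where "lookup \<equiv> Poly_Mapping.lookup"

section \<open>Cones of monomials\<close>

definition cone :: "(nat \<Rightarrow>\<^sub>0 nat) \<Rightarrow> nat set \<Rightarrow> (nat \<Rightarrow>\<^sub>0 nat) set"
  where "cone u Z = (+) u ` monomials Z"

text \<open>Divisibility by \<open>u\<close> with a cofactor in the variables of \<open>Z\<close>
  can be tested one exponent at a time, which makes later questions about cones a matter of
  simplification.\<close>

lemma in_cone_iff:
  "m \<in> cone u Z \<longleftrightarrow> (\<forall>i. lookup u i \<le> lookup m i \<and> (i \<notin> Z \<longrightarrow> lookup m i = lookup u i))"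
proof
  assume "m \<in> cone u Z"
  then show "\<forall>i. lookup u i \<le> lookup m i \<and> (i \<notin> Z \<longrightarrow> lookup m i = lookup u i)"
    by (auto simp: cone_def monomials_def lookup_add in_keys_iff)
next
  assume *: "\<forall>i. lookup u i \<le> lookup m i \<and> (i \<notin> Z \<longrightarrow> lookup m i = lookup u i)"
  \<comment> \<open>Subtraction of exponents is truncated, so this relies on \<open>u\<close> being
    below \<open>m\<close> in every coordinate.\<close>
  then have "m = u + (m - u)"
    by (intro poly_mapping_eqI) (simp add: lookup_add lookup_minus)
  moreover have "m - u \<in> monomials Z"
    using * by (auto simp: monomials_def in_keys_iff lookup_minus)
  ultimately show "m \<in> cone u Z"
    unfolding cone_def by blast
qed

lemma cone_subset_monomials:
  assumes "u \<in> monomials V" "Z \<subseteq> V"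
  shows "cone u Z \<subseteq> monomials V"
proof -
  have "keys (u + w) \<subseteq> V" if "keys w \<subseteq> Z" for w
    using Poly_Mapping.keys_add[of u w] assms that by (auto simp: monomials_def)
  then show ?thesis
    by (auto simp: cone_def monomials_def)
qed

section \<open>Spans of monomials and their direct sums\<close>

lemma scale_monom: "scale c (monom m) = Poly_Mapping.single m c"
  by (simp add: scale_def monom_def mult_single)

lemma poly_mapping_eq_sum_single: "p = (\<Sum>m\<in>keys p. Poly_Mapping.single m (lookup p m))"
  by (intro poly_mapping_eqI) (auto simp: lookup_sum lookup_single when_def in_keys_iff)

text \<open>Linear operations never enlarge the support beyond \<open>A\<close>, and every
  polynomial is the sum of its terms. This replaces spans by conditions on supports.\<close>

lemma kspan_monom: "kspan (monom ` A) = {p :: 'k::field mpoly. keys p \<subseteq> A}"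
proof
  show "kspan (monom ` A) \<subseteq> {p :: 'k mpoly. keys p \<subseteq> A}"
  proof (rule mpoly.span_minimal)
    show "monom ` A \<subseteq> {p :: 'k mpoly. keys p \<subseteq> A}"
      by (auto simp: monom_def)
    show "mpoly.subspace {p :: 'k mpoly. keys p \<subseteq> A}"
    proof (rule mpoly.subspaceI)
      fix x y :: "'k mpoly"
      assume "x \<in> {p. keys p \<subseteq> A}" "y \<in> {p. keys p \<subseteq> A}"
      then show "x + y \<in> {p. keys p \<subseteq> A}"
        using Poly_Mapping.keys_add[of x y] by blast
    next
      fix c and x :: "'k mpoly"
      assume "x \<in> {p. keys p \<subseteq> A}"
      moreover have "keys (scale c x) \<subseteq> keys x"
        using Poly_Mapping.keys_mult[of "Poly_Mapping.single 0 c" x]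
        by (auto simp: scale_def split: if_splits)
      ultimately show "scale c x \<in> {p. keys p \<subseteq> A}"
        by blast
    qed simp
  qed
  show "{p :: 'k mpoly. keys p \<subseteq> A} \<subseteq> kspan (monom ` A)"
  proof
    fix p :: "'k mpoly"
    assume "p \<in> {p. keys p \<subseteq> A}"
    then have "(\<Sum>m\<in>keys p. scale (lookup p m) (monom m)) \<in> kspan (monom ` A)"
      by (intro mpoly.span_sum mpoly.span_scale mpoly.span_base) auto
    then show "p \<in> kspan (monom ` A)"
      by (simp only: scale_monom flip: poly_mapping_eq_sum_single)
  qed
qed

text \<open>The subspaces involved are all spanned by parts of one basis, so directness can be read
  off from the parts: existence of a representation amounts to covering, uniqueness to
  disjointness.\<close>

lemma is_direct_sum_keys_iff:
  fixes A :: "'b set"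
  assumes fin: "finite D"
  shows "is_direct_sum {p :: 'b \<Rightarrow>\<^sub>0 'k::ring_1. keys p \<subseteq> A} D (\<lambda>d. {p. keys p \<subseteq> B d}) \<longleftrightarrow>
    A = (\<Union>d\<in>D. B d) \<and> disjoint_family_on B D"
    (is "?direct \<longleftrightarrow> ?partition")
proof
  assume d: ?direct
  have W: "{p :: 'b \<Rightarrow>\<^sub>0 'k. keys p \<subseteq> A} = {(\<Sum>i\<in>D. f i) |f. \<forall>i\<in>D. keys (f i) \<subseteq> B i}"
    and uniq: "\<And>f :: _ \<Rightarrow> 'b \<Rightarrow>\<^sub>0 'k. \<lbrakk>\<forall>i\<in>D. keys (f i) \<subseteq> B i; (\<Sum>i\<in>D. f i) = 0\<rbrakk>
      \<Longrightarrow> \<forall>i\<in>D. f i = 0"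
    using d unfolding is_direct_sum_def by simp_all
  have "A \<subseteq> (\<Union>d\<in>D. B d)"
  proof
    fix m assume "m \<in> A"
    then have "Poly_Mapping.single m 1 \<in> {p :: 'b \<Rightarrow>\<^sub>0 'k. keys p \<subseteq> A}"
      by simp
    then obtain f :: "_ \<Rightarrow> 'b \<Rightarrow>\<^sub>0 'k"
      where f: "\<forall>i\<in>D. keys (f i) \<subseteq> B i" "Poly_Mapping.single m 1 = (\<Sum>i\<in>D. f i)"
      unfolding W by blast
    \<comment> \<open>Comparing coefficients at \<open>m\<close> shows that some summand must
      involve \<open>m\<close>.\<close>
    have "(\<Sum>i\<in>D. lookup (f i) m) \<noteq> 0"
      using f(2) by (metis lookup_single_eq lookup_sum one_neq_zero)
    then obtain i where "i \<in> D" "lookup (f i) m \<noteq> 0"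
      by (meson sum.neutral)
    with f(1) show "m \<in> (\<Union>d\<in>D. B d)"
      by (metis UN_iff in_keys_iff subsetD)
  qed
  moreover have "B i \<subseteq> A" if i: "i \<in> D" for i
  proof
    fix m assume m: "m \<in> B i"
    define f :: "_ \<Rightarrow> 'b \<Rightarrow>\<^sub>0 'k" where "f j = (if j = i then Poly_Mapping.single m 1 else 0)" for j
    have "(\<Sum>j\<in>D. f j) \<in> {p :: 'b \<Rightarrow>\<^sub>0 'k. keys p \<subseteq> A}"
      unfolding W using m by (intro CollectI exI[of _ f]) (simp add: f_def)
    moreover have "(\<Sum>j\<in>D. f j) = Poly_Mapping.single m 1"
      using fin i by (simp add: f_def)
    ultimately show "m \<in> A"
      by simp
  qed
  moreover have "B i \<inter> B j = {}" if ij: "i \<in> D" "j \<in> D" "i \<noteq> j" for i j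
  proof (rule ccontr)
    assume "B i \<inter> B j \<noteq> {}"
    then obtain m where m: "m \<in> B i" "m \<in> B j"
      by blast
    \<comment> \<open>A shared \<open>m\<close> yields the nontrivial relation
      \<open>m - m = 0\<close> between the summands at \<open>i\<close> and
      \<open>j\<close>.\<close>
    define f :: "_ \<Rightarrow> 'b \<Rightarrow>\<^sub>0 'k" where "f l = (if l = i then Poly_Mapping.single m 1 else 0) -
        (if l = j then Poly_Mapping.single m 1 else 0)" for l
    have "(\<Sum>l\<in>D. f l) = 0"
      using fin ij by (simp add: f_def sum_subtractf)
    moreover have "\<forall>l\<in>D. keys (f l) \<subseteq> B l"
      using m by (auto simp: f_def)
    ultimately have "f i = 0"
      using uniq ij(1) by blast
    then show False
      using ij(3) by (auto simp: f_def dest: arg_cong[of _ _ keys])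
  qed
  ultimately show ?partition
    unfolding disjoint_family_on_def by blast
next
  assume p: ?partition
  then have A: "A = (\<Union>d\<in>D. B d)" and disj: "disjoint_family_on B D"
    by blast+
  have "\<exists>f. p = (\<Sum>i\<in>D. f i) \<and> (\<forall>i\<in>D. keys (f i) \<subseteq> B i)"
    if "keys p \<subseteq> A" for p :: "'b \<Rightarrow>\<^sub>0 'k"
  proof (intro exI conjI ballI)
    \<comment> \<open>The component at \<open>i\<close> collects the terms of \<open>p\<close> whose
      index lies in \<open>B i\<close>; by disjointness no term is counted twice.\<close>
    let ?f = "\<lambda>i. \<Sum>m\<in>keys p \<inter> B i. Poly_Mapping.single m (lookup p m)"
    have "keys p = (\<Union>i\<in>D. keys p \<inter> B i)"
      using that A by blast
    then have "p = (\<Sum>m\<in>(\<Union>i\<in>D. keys p \<inter> B i). Poly_Mapping.single m (lookup p m))"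
      using poly_mapping_eq_sum_single[of p] by simp
    also have "\<dots> = (\<Sum>i\<in>D. ?f i)"
      using disj by (intro sum.UNION_disjoint fin) (auto simp: disjoint_family_on_def)
    finally show "p = (\<Sum>i\<in>D. ?f i)" .
    show "keys (?f i) \<subseteq> B i" for i
      using Poly_Mapping.keys_sum[of "\<lambda>m. Poly_Mapping.single m (lookup p m)" "keys p \<inter> B i"]
      by (auto split: if_splits)
  qed
  moreover have "keys (\<Sum>i\<in>D. f i) \<subseteq> A"
    if "\<forall>i\<in>D. keys (f i) \<subseteq> B i" for f :: "_ \<Rightarrow> 'b \<Rightarrow>\<^sub>0 'k"
    using Poly_Mapping.keys_sum[of f D] that A by blast
  moreover have "f i = 0"
    if f: "\<forall>i\<in>D. keys (f i) \<subseteq> B i" "(\<Sum>i\<in>D. f i) = 0" and i: "i \<in> D"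
    for f :: "_ \<Rightarrow> 'b \<Rightarrow>\<^sub>0 'k" and i
  proof (rule ccontr)
    assume "f i \<noteq> 0"
    then obtain m where m: "m \<in> keys (f i)"
      by (metis equals0I keys_eq_empty)
    \<comment> \<open>By disjointness only the summand at \<open>i\<close> can contribute at
      \<open>m\<close>, so its coefficient there survives in the total.\<close>
    have "lookup (f j) m = 0" if "j \<in> D - {i}" for j
      using that f(1) m i disj unfolding disjoint_family_on_def
      by (metis DiffD1 DiffD2 IntI empty_iff in_keys_iff singletonI subsetD)
    then have "(\<Sum>j\<in>D. lookup (f j) m) = lookup (f i) m"
      using i fin by (simp add: sum.remove[of D i])
    with f(2) m show False
      by (metis in_keys_iff lookup_sum lookup_zero)
  qed
  ultimately show ?direct
    unfolding is_direct_sum_def set_eq_iff mem_Collect_eq by blast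
qed

text \<open>The complement and all Stanley spaces are spans of monomials, so linear algebra drops
  out: what remains is a partition of exponent vectors into cones.\<close>

lemma stanley_decomposition_iff:
  fixes I :: "'k::field mpoly set"
  shows "stanley_decomposition V I D \<longleftrightarrow> finite D \<and> D \<subseteq> monomials V \<times> Pow V \<and>
    {m \<in> monomials V. monom m \<notin> I} = (\<Union>(u, Z)\<in>D. cone u Z) \<and>
    disjoint_family_on (\<lambda>(u, Z). cone u Z) D"
proof -
  have W: "monomial_complement V I = {p. keys p \<subseteq> {m \<in> monomials V. monom m \<notin> I}}"
    by (simp add: monomial_complement_def setcompr_eq_image flip: kspan_monom)
  have U: "stanley_space u Z = {p :: 'k mpoly. keys p \<subseteq> cone u Z}" for u Z
    by (simp add: stanley_space_def cone_def setcompr_eq_image image_image flip: kspan_monom)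
  have "(\<lambda>(u, Z). stanley_space u Z) = (\<lambda>d. {p :: 'k mpoly. keys p \<subseteq> (case d of (u, Z) \<Rightarrow> cone u Z)})"
    by (auto simp: U)
  then show ?thesis
    unfolding stanley_decomposition_def W by (simp only: is_direct_sum_keys_iff cong: conj_cong)
qed

section \<open>Monomials in the Stanley-Reisner ideal\<close>

lemma prod_var: "finite G \<Longrightarrow> (\<Prod>i\<in>G. var i) = monom (\<Sum>i\<in>G. Poly_Mapping.single i 1)"
  by (induction G rule: finite_induct) (simp_all add: var_def monom_def mult_single)

lemma lookup_sum_single:
  "finite G \<Longrightarrow> lookup (\<Sum>i\<in>G. Poly_Mapping.single i (1::nat)) j = (if j \<in> G then 1 else 0)"
  by (simp add: lookup_sum lookup_single when_def)

text \<open>Multiplication can only enlarge the support of a monomial, and supersets of nonfaces are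
  nonfaces. Conversely, a monomial is a multiple of the squarefree monomial on its support, which is
  a generator if that support is a nonface.\<close>

lemma monom_in_stanley_reisner_ideal_iff:
  assumes \<Delta>: "simplicial_complex_on V \<Delta>" and m: "m \<in> monomials V"
  shows "(monom m :: 'k::field mpoly) \<in> stanley_reisner_ideal V \<Delta> \<longleftrightarrow> keys m \<notin> \<Delta>"
proof -
  interpret R: cring "poly_ring V :: 'k mpoly ring"
    by (rule cring_poly_ring)
  define gens :: "'k mpoly set" where "gens = {(\<Prod>i\<in>G. var i) |G. G \<subseteq> V \<and> G \<notin> \<Delta>}"
  \<comment> \<open>The polynomials supported on \<open>N\<close> will form an ideal containing the
    generators, which bounds the Stanley-Reisner ideal from above.\<close>
  define N where "N = {m \<in> monomials V. keys m \<notin> \<Delta>}"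
  have finV: "finite V" and down: "\<And>F G. F \<in> \<Delta> \<Longrightarrow> G \<subseteq> F \<Longrightarrow> G \<in> \<Delta>"
    using \<Delta> by (auto simp: simplicial_complex_on_def)
  \<comment> \<open>Natural exponents cannot cancel, hence equality rather than the general
    inclusion.\<close>
  have key_add: "keys (a + b) = keys a \<union> keys b" for a b :: "nat \<Rightarrow>\<^sub>0 nat"
    by (auto simp: in_keys_iff lookup_add)
  have N_add: "a + b \<in> N" if "a \<in> N" "b \<in> monomials V" for a b
    using that down[of "keys (a + b)" "keys a"] by (auto simp: N_def monomials_def key_add)
  have N_V: "N \<subseteq> monomials V"
    by (auto simp: N_def)
  have keys_sum_single: "keys (\<Sum>i\<in>G. Poly_Mapping.single i (1::nat)) = G" if "G \<subseteq> V" for G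
    using finite_subset[OF that finV]
    by (auto simp: in_keys_iff lookup_sum_single simp del: One_nat_def split: if_splits)
  have gens_N: "gens \<subseteq> {p. keys p \<subseteq> N}"
  proof
    fix p assume "p \<in> gens"
    then obtain G where G: "G \<subseteq> V" "G \<notin> \<Delta>" "p = (\<Prod>i\<in>G. var i)"
      by (auto simp: gens_def)
    then have "p = monom (\<Sum>i\<in>G. Poly_Mapping.single i 1)"
      using finV by (simp add: prod_var finite_subset)
    then show "p \<in> {p. keys p \<subseteq> N}"
      using G(1,2) keys_sum_single[of G] by (simp add: monom_def N_def monomials_def)
  qed
  have gens_carrier: "gens \<subseteq> carrier (poly_ring V)"
    using gens_N N_V by (auto simp: poly_ring_def)
  have "ideal {p. keys p \<subseteq> N} (poly_ring V :: 'k mpoly ring)"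
  proof (rule idealI)
    show "subgroup {p. keys p \<subseteq> N} (add_monoid (poly_ring V :: 'k mpoly ring))"
    proof (rule R.add.subgroupI)
      show "{p :: 'k mpoly. keys p \<subseteq> N} \<subseteq> carrier (poly_ring V)"
        using N_V by (auto simp: poly_ring_def)
      show "{p :: 'k mpoly. keys p \<subseteq> N} \<noteq> {}"
        by (auto intro: exI[of _ 0])
    next
      fix p :: "'k mpoly" assume p: "p \<in> {p. keys p \<subseteq> N}"
      have "\<ominus>\<^bsub>poly_ring V\<^esub> p = - p"
        using p N_V by (intro R.minus_equality) (auto simp: poly_ring_def)
      with p show "\<ominus>\<^bsub>poly_ring V\<^esub> p \<in> {p. keys p \<subseteq> N}"
        by simp
    next
      fix p q :: "'k mpoly" assume "p \<in> {p. keys p \<subseteq> N}" "q \<in> {p. keys p \<subseteq> N}"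
      then show "p \<oplus>\<^bsub>poly_ring V\<^esub> q \<in> {p. keys p \<subseteq> N}"
        using Poly_Mapping.keys_add[of p q] by (auto simp: poly_ring_def)
    qed
  next
    fix p q :: "'k mpoly"
    assume p: "p \<in> {p. keys p \<subseteq> N}" and q: "q \<in> carrier (poly_ring V)"
    have "keys (p * q) \<subseteq> N"
      using Poly_Mapping.keys_mult[of p q] p q N_add by (fastforce simp: poly_ring_def)
    then show "p \<otimes>\<^bsub>poly_ring V\<^esub> q \<in> {p. keys p \<subseteq> N}" "q \<otimes>\<^bsub>poly_ring V\<^esub> p \<in> {p. keys p \<subseteq> N}"
      by (simp_all add: poly_ring_def mult.commute)
  qed (rule R.ring_axioms)
  then have I_N: "stanley_reisner_ideal V \<Delta> \<subseteq> {p :: 'k mpoly. keys p \<subseteq> N}"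
    unfolding stanley_reisner_ideal_def gens_def[symmetric]
    using gens_N by (rule R.genideal_minimal)
  show ?thesis
  proof
    assume "(monom m :: 'k mpoly) \<in> stanley_reisner_ideal V \<Delta>"
    with I_N have "keys (monom m :: 'k mpoly) \<subseteq> N"
      by blast
    then show "keys m \<notin> \<Delta>"
      by (simp add: monom_def N_def)
  next
    assume "keys m \<notin> \<Delta>"
    \<comment> \<open>The squarefree monomial on the support of \<open>m\<close>. It divides
      \<open>m\<close>, so the truncated difference \<open>m - s\<close> is the true
      cofactor.\<close>
    define s where "s = (\<Sum>i\<in>keys m. Poly_Mapping.single i (1::nat))"
    have "(monom s :: 'k mpoly) = (\<Prod>i\<in>keys m. var i)"
      by (simp add: s_def prod_var)
    then have s: "(monom s :: 'k mpoly) \<in> gens"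
      using m \<open>keys m \<notin> \<Delta>\<close> unfolding gens_def by (auto simp: monomials_def)
    interpret I: ideal "stanley_reisner_ideal V \<Delta>" "poly_ring V :: 'k mpoly ring"
      unfolding stanley_reisner_ideal_def gens_def[symmetric]
      by (rule R.genideal_ideal[OF gens_carrier])
    have "(monom s :: 'k mpoly) \<in> stanley_reisner_ideal V \<Delta>"
      using s R.genideal_self[OF gens_carrier]
      unfolding stanley_reisner_ideal_def gens_def[symmetric] by blast
    moreover have "(monom (m - s) :: 'k mpoly) \<in> carrier (poly_ring V)"
      using m by (auto simp: poly_ring_def monom_def monomials_def in_keys_iff lookup_minus)
    ultimately have "(monom s * monom (m - s) :: 'k mpoly) \<in> stanley_reisner_ideal V \<Delta>"
      using I.I_r_closed by (simp add: poly_ring_def)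
    moreover have "s + (m - s) = m"
      by (intro poly_mapping_eqI)
        (auto simp: s_def lookup_add lookup_minus lookup_sum_single in_keys_iff simp del: One_nat_def)
    ultimately show "(monom m :: 'k mpoly) \<in> stanley_reisner_ideal V \<Delta>"
      by (simp add: monom_def mult_single)
  qed
qed

section \<open>Slicing cones at a fixed height\<close>

text \<open>Since \<open>k\<close> exceeds the exponent of \<open>v\<close> in \<open>u\<close>,
  height \<open>k\<close> is reached only if \<open>v\<close> is a free direction. The coordinate
  \<open>v\<close> then imposes no condition and can be set to zero on both sides.\<close>

lemma add_single_in_cone_iff:
  assumes "lookup u v < k" "lookup m v = 0"
  shows "m + Poly_Mapping.single v k \<in> cone u Z \<longleftrightarrow>
    v \<in> Z \<and> m \<in> cone (Poly_Mapping.update v 0 u) (Z - {v})"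
  using assms by (auto simp: in_cone_iff lookup_add lookup_single lookup_update when_def)

definition slice :: "nat \<Rightarrow> ((nat \<Rightarrow>\<^sub>0 nat) \<times> nat set) set \<Rightarrow> ((nat \<Rightarrow>\<^sub>0 nat) \<times> nat set) set"
  where "slice v D = {(Poly_Mapping.update v 0 u, Z - {v}) |u Z. (u, Z) \<in> D \<and> v \<in> Z}"

text \<open>Covering and disjointness both transfer from \<open>D\<close> to its slices along the
  map that adds \<open>k\<close> to the exponent of \<open>v\<close>.\<close>

lemma stanley_decomposition_slice:
  assumes \<Delta>: "simplicial_complex_on V \<Delta>" and v: "v \<in> V"
    and D: "stanley_decomposition V (stanley_reisner_ideal V \<Delta> :: 'k::field mpoly set) D"
  shows "stanley_decomposition (V - {v})
    (stanley_reisner_ideal (V - {v}) (vertex_link V \<Delta> v) :: 'k mpoly set) (slice v D)"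
proof -
  have fin: "finite D" and DV: "D \<subseteq> monomials V \<times> Pow V"
    and cover: "{m \<in> monomials V. (monom m :: 'k mpoly) \<notin> stanley_reisner_ideal V \<Delta>} =
      (\<Union>(u, Z)\<in>D. cone u Z)"
    and disj: "disjoint_family_on (\<lambda>(u, Z). cone u Z) D"
    using D by (simp_all add: stanley_decomposition_iff)
  obtain k where k: "\<And>u Z. (u, Z) \<in> D \<Longrightarrow> lookup u v < k"
  proof -
    have "finite ((\<lambda>(u, Z). lookup u v) ` D)"
      using fin by simp
    then obtain k where "\<forall>j\<in>(\<lambda>(u, Z). lookup u v) ` D. j < k"
      unfolding finite_nat_set_iff_bounded by blast
    then show thesis
      by (intro that[of k]) force
  qed
  let ?up = "\<lambda>m. m + Poly_Mapping.single v k"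
  have cone_iff: "?up m \<in> cone u Z \<longleftrightarrow> v \<in> Z \<and> m \<in> cone (Poly_Mapping.update v 0 u) (Z - {v})"
    if "(u, Z) \<in> D" "m \<in> monomials (V - {v})" for m u Z
    using that by (intro add_single_in_cone_iff k) (auto simp: monomials_def in_keys_iff)
  have "Poly_Mapping.update v 0 u \<in> monomials (V - {v})" if "u \<in> monomials V" for u
    using that by (auto simp: monomials_def in_keys_iff lookup_update split: if_splits)
  then have slice_V: "slice v D \<subseteq> monomials (V - {v}) \<times> Pow (V - {v})"
    using DV by (auto simp: slice_def)
  have "slice v D \<subseteq> (\<lambda>(u, Z). (Poly_Mapping.update v 0 u, Z - {v})) ` D"
    by (auto simp: slice_def)
  then have fin': "finite (slice v D)"
    using fin by (meson finite_imageI finite_subset)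
  have slice_cone_V: "cone u Z \<subseteq> monomials (V - {v})" if "(u, Z) \<in> slice v D" for u Z
    using that slice_V by (intro cone_subset_monomials) auto
  have cover_iff: "(\<exists>(u, Z)\<in>slice v D. m \<in> cone u Z) \<longleftrightarrow> insert v (keys m) \<in> \<Delta>"
    if m: "m \<in> monomials (V - {v})" for m
  proof (cases "D = {}")
    \<comment> \<open>For empty \<open>D\<close> the bound \<open>k\<close> may be 0, hence the
      separate case: the monomial 1 lies in the ideal, so even the empty face is missing and
      \<open>\<Delta>\<close> is empty.\<close>
    case True
    then have "{} \<notin> \<Delta>"
      using cover monom_in_stanley_reisner_ideal_iff[OF \<Delta> zero_in_monomials, where 'k = 'k]
        zero_in_monomials[of V] by auto
    then have "\<Delta> = {}"
      using \<Delta> by (auto simp: simplicial_complex_on_def)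
    with True show ?thesis
      by (simp add: slice_def)
  next
    case False
    \<comment> \<open>Some exponent is strictly below \<open>k\<close>. Positivity is what puts
      \<open>v\<close> into the support of \<open>?up m\<close>.\<close>
    then have "k > 0"
      using k by fastforce
    then have keys_up: "keys (?up m) = insert v (keys m)"
      by (auto simp: in_keys_iff lookup_add lookup_single when_def split: if_splits)
    then have up_V: "?up m \<in> monomials V"
      using m v by (auto simp: monomials_def)
    have "(\<exists>(u, Z)\<in>slice v D. m \<in> cone u Z) \<longleftrightarrow> (\<exists>(u, Z)\<in>D. ?up m \<in> cone u Z)"
      using cone_iff[OF _ m] unfolding slice_def by fast
    also have "\<dots> \<longleftrightarrow> ?up m \<in> (\<Union>(u, Z)\<in>D. cone u Z)"
      by blast
    also have "\<dots> \<longleftrightarrow> insert v (keys m) \<in> \<Delta>"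
      unfolding cover[symmetric]
      using up_V by (simp add: monom_in_stanley_reisner_ideal_iff[OF \<Delta>] keys_up)
    finally show ?thesis .
  qed
  have "keys m \<in> vertex_link V \<Delta> v \<longleftrightarrow> insert v (keys m) \<in> \<Delta>" if "m \<in> monomials (V - {v})" for m
    using that by (auto simp: vertex_link_def monomials_def)
  then have "{m \<in> monomials (V - {v}).
      (monom m :: 'k mpoly) \<notin> stanley_reisner_ideal (V - {v}) (vertex_link V \<Delta> v)} =
      {m \<in> monomials (V - {v}). insert v (keys m) \<in> \<Delta>}"
    using monom_in_stanley_reisner_ideal_iff[OF simplicial_complex_on_vertex_link[OF \<Delta>]] by blast
  also have "\<dots> = (\<Union>(u, Z)\<in>slice v D. cone u Z)"
    \<comment> \<open>\<open>cover_iff\<close> speaks only of monomials over \<open>V - {v}\<close>;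
      \<open>slice_cone_V\<close> ensures that the sliced cones contain no others.\<close>
    using cover_iff slice_cone_V by blast
  finally have cover': "{m \<in> monomials (V - {v}).
      (monom m :: 'k mpoly) \<notin> stanley_reisner_ideal (V - {v}) (vertex_link V \<Delta> v)} =
      (\<Union>(u, Z)\<in>slice v D. cone u Z)" .
  have "disjoint_family_on (\<lambda>(u, Z). cone u Z) (slice v D)"
    unfolding disjoint_family_on_def
  proof (intro ballI impI, rule ccontr)
    fix d e assume de: "d \<in> slice v D" "e \<in> slice v D" "d \<noteq> e"
      and "(case d of (u, Z) \<Rightarrow> cone u Z) \<inter> (case e of (u, Z) \<Rightarrow> cone u Z) \<noteq> {}"
    then obtain m where m: "m \<in> (case d of (u, Z) \<Rightarrow> cone u Z)" "m \<in> (case e of (u, Z) \<Rightarrow> cone u Z)"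
      by blast
    obtain u Z where d: "(u, Z) \<in> D" "v \<in> Z" "d = (Poly_Mapping.update v 0 u, Z - {v})"
      using de(1) unfolding slice_def by blast
    obtain u' Z' where e: "(u', Z') \<in> D" "v \<in> Z'" "e = (Poly_Mapping.update v 0 u', Z' - {v})"
      using de(2) unfolding slice_def by blast
    have mV: "m \<in> monomials (V - {v})"
      using m(1) slice_cone_V de(1) d(3) by auto
    \<comment> \<open>A monomial shared by two slices lifts to one shared by the cones they come
      from.\<close>
    have "?up m \<in> cone u Z" "?up m \<in> cone u' Z'"
      using m cone_iff[OF _ mV] d e by auto
    moreover have "(u, Z) \<noteq> (u', Z')"
      using de(3) d(3) e(3) by auto
    ultimately show False
      using disjoint_family_onD[OF disj d(1) e(1)] by auto
  qed
  with fin' slice_V cover' show ?thesis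
    by (simp add: stanley_decomposition_iff)
qed

section \<open>Comparison of Stanley depths\<close>

text \<open>Each slice loses exactly the direction \<open>v\<close>, so a slice of least dimension
  comes from a cone with one dimension more. An empty slice has depth \<open>\<infinity>\<close>,
  and the bound is then trivial.\<close>

lemma sdepth_decomposition_slice:
  assumes "\<And>u Z. (u, Z) \<in> D \<Longrightarrow> finite Z"
  shows "sdepth_decomposition D \<le> sdepth_decomposition (slice v D) + 1"
proof (cases "sdepth_decomposition (slice v D)")
  case (enat j)
  \<comment> \<open>The strict bound by \<open>Suc j\<close> lets the infimum produce an actual pair
    of dimension at most \<open>j\<close>.\<close>
  then have "(INF (u, Z)\<in>slice v D. enat (card Z)) < enat (Suc j)"
    by (simp add: sdepth_decomposition_def)
  then obtain u Z where uZ: "(u, Z) \<in> D" "v \<in> Z" "card (Z - {v}) \<le> j"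
    by (auto simp: INF_less_iff slice_def)
  then have "card Z \<le> j + 1"
    using assms by (simp add: card_Diff_singleton)
  moreover have "sdepth_decomposition D \<le> enat (card Z)"
    unfolding sdepth_decomposition_def using uZ(1) by (auto intro: INF_lower2)
  ultimately show ?thesis
    using enat by (metis enat_ord_simps(1) one_enat_def order_trans plus_enat_simps(1))
qed simp

text \<open>Adding 1 on the right keeps the comparison inside \<open>enat\<close>, away from its
  truncated subtraction.\<close>

lemma sdepth_le_sdepth_vertex_link:
  assumes "simplicial_complex_on V \<Delta>" "v \<in> V"
  shows "sdepth V (stanley_reisner_ideal V \<Delta> :: 'k::field mpoly set) \<le>
    sdepth (V - {v}) (stanley_reisner_ideal (V - {v}) (vertex_link V \<Delta> v) :: 'k mpoly set) + 1"
  unfolding sdepth_def[of V]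
proof (rule SUP_least)
  fix D assume "D \<in> {D. stanley_decomposition V (stanley_reisner_ideal V \<Delta> :: 'k mpoly set) D}"
  then have D: "stanley_decomposition V (stanley_reisner_ideal V \<Delta> :: 'k mpoly set) D"
    by simp
  have "finite Z" if "(u, Z) \<in> D" for u Z
    using that D assms(1) finite_subset
    by (auto simp: stanley_decomposition_def simplicial_complex_on_def)
  then have "sdepth_decomposition D \<le> sdepth_decomposition (slice v D) + 1"
    by (rule sdepth_decomposition_slice)
  also have "\<dots> \<le> sdepth (V - {v})
      (stanley_reisner_ideal (V - {v}) (vertex_link V \<Delta> v) :: 'k mpoly set) + 1"
    unfolding sdepth_def using stanley_decomposition_slice[OF assms D]
    by (intro add_right_mono SUP_upper) simp
  finally show "sdepth_decomposition D \<le> sdepth (V - {v})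
      (stanley_reisner_ideal (V - {v}) (vertex_link V \<Delta> v) :: 'k mpoly set) + 1" .
qed

text \<open>The inequality is stated in the extended reals, where subtracting 1 is not cut off at 0
  and \<open>\<infinity> - 1 = \<infinity>\<close>.\<close>

theorem corollary3p8:
  fixes n :: nat and \<Delta> :: "nat set set"
  assumes "n \<ge> 1"
    and "simplicial_complex_on {1..n} \<Delta>"
  shows "ereal_of_enat (sdepth {1..n - 1}
            (stanley_reisner_ideal {1..n - 1} (vertex_link {1..n} \<Delta> n) :: 'k::field mpoly set))
         \<ge> ereal_of_enat (sdepth {1..n} (stanley_reisner_ideal {1..n} \<Delta> :: 'k mpoly set)) - 1"
    (is "ereal_of_enat ?link \<ge> ereal_of_enat ?s - 1")
proof -
  have "{1..n} - {n} = {1..n - 1}"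
    using assms(1) by auto
  then have "?s \<le> ?link + 1"
    using sdepth_le_sdepth_vertex_link[OF assms(2), of n, where 'k = 'k] assms(1) by simp
  \<comment> \<open>The case split checks that the embedding respects adding 1 also at infinite
    values.\<close>
  then have "ereal_of_enat ?s \<le> ereal_of_enat ?link + 1"
    by (cases ?s; cases ?link) (simp_all add: one_enat_def)
  then show ?thesis
    by (simp add: ereal_minus_le_iff add.commute)
qed

end
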